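(* Let $N$ be a strong negation. Let $M:[0,1]^2\to[0,1]$ be a binary aggregation function that is commutative, one strict, without zero divisors, and satisfies $M(0,1)=0$. If a mapping $f:[0,1]^2\to[0,1]$ satisfies (I1), (CC), (CP($N$)) and (OP), then $G(x,y)=M(f(x,y),f(y,x))$ is a restricted equivalence function (with strong negation $N$ in (REF4)).
   Context: A strong negation is a non-increasing map $N:[0,1]\to[0,1]$ with $N(0)=1$, $N(1)=0$ and $N(N(x))=x$ for all $x$. A binary aggregation function is a map $M:[0,1]^2\to[0,1]$ with $M(0,0)=0$, $M(1,1)=1$, non-decreasing in each variable; commutative means $M(x,y)=M(y,x)$. $M$ is one strict if $M(x,y)=1$ implies $x=1$ and $y=1$. A zero divisor of $M$ is an $x\in(0,1)$ such that $M(x,y)=0$ for some $y\in(0,1)$. For $f:[0,1]^2\to[0,1]$: (I1) $f$ is non-increasing in the first variable; (CC) $f(x,y)=0\iff x=1,\ y=0$; (CP($N$)) $f(x,y)=f(N(y),N(x))$ for all $x,y$; (OP) $f(x,y)=1\iff x\le y$, for all $x,y$. A restricted equivalence function (REF) with strong negation $N$ is a map $F:[0,1]^2\to[0,1]$ such that for all $x,y,z\in[0,1]$: (REF1) $F(x,y)=F(y,x)$; (REF2) $F(x,y)=1\iff x=y$; (REF3) $F(x,y)=0\iff (x=1,y=0)$ or $(x=0,y=1)$; (REF4) $F(x,y)=F(N(x),N(y))$; (REF5) $F(x,z)\le F(x,y)$ if $x\le y\le z$. *)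

theory Defs
  imports Complex_Main "HOL-Library.FuncSet"
begin

text \<open>
  Maps on the unit interval and the unit square are total functions on \<^typ>\<open>real\<close>;
  every condition constrains their values on \<open>[0,1]\<close> only, and values outside are irrelevant.
  Binary maps are curried.
\<close>

abbreviation unit_ivl :: "real set" where
  "unit_ivl \<equiv> {0..1}"

definition strong_negation :: "(real \<Rightarrow> real) \<Rightarrow> bool" where
  "strong_negation N \<longleftrightarrow>
     N \<in> unit_ivl \<rightarrow> unit_ivl \<and> antimono_on unit_ivl N \<and>
     N 0 = 1 \<and> N 1 = 0 \<and> (\<forall>x\<in>unit_ivl. N (N x) = x)"

definition unit_binary_map :: "(real \<Rightarrow> real \<Rightarrow> real) \<Rightarrow> bool" where
  "unit_binary_map f \<longleftrightarrow> f \<in> unit_ivl \<rightarrow> unit_ivl \<rightarrow> unit_ivl"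

definition aggregation_function :: "(real \<Rightarrow> real \<Rightarrow> real) \<Rightarrow> bool" where
  "aggregation_function M \<longleftrightarrow>
     unit_binary_map M \<and> M 0 0 = 0 \<and> M 1 1 = 1 \<and>
     (\<forall>y\<in>unit_ivl. mono_on unit_ivl (\<lambda>x. M x y)) \<and>
     (\<forall>x\<in>unit_ivl. mono_on unit_ivl (\<lambda>y. M x y))"

definition commutative_map :: "(real \<Rightarrow> real \<Rightarrow> real) \<Rightarrow> bool" where
  "commutative_map M \<longleftrightarrow> (\<forall>x\<in>unit_ivl. \<forall>y\<in>unit_ivl. M x y = M y x)"

definition one_strict :: "(real \<Rightarrow> real \<Rightarrow> real) \<Rightarrow> bool" where
  "one_strict M \<longleftrightarrow> (\<forall>x\<in>unit_ivl. \<forall>y\<in>unit_ivl. M x y = 1 \<longrightarrow> x = 1 \<and> y = 1)"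

definition zero_divisor :: "(real \<Rightarrow> real \<Rightarrow> real) \<Rightarrow> real \<Rightarrow> bool" where
  "zero_divisor M x \<longleftrightarrow> x \<in> {0<..<1} \<and> (\<exists>y\<in>{0<..<1}. M x y = 0)"

definition prop_I1 :: "(real \<Rightarrow> real \<Rightarrow> real) \<Rightarrow> bool" where
  "prop_I1 f \<longleftrightarrow> (\<forall>y\<in>unit_ivl. antimono_on unit_ivl (\<lambda>x. f x y))"

definition prop_CC :: "(real \<Rightarrow> real \<Rightarrow> real) \<Rightarrow> bool" where
  "prop_CC f \<longleftrightarrow> (\<forall>x\<in>unit_ivl. \<forall>y\<in>unit_ivl. f x y = 0 \<longleftrightarrow> x = 1 \<and> y = 0)"

definition prop_CP :: "(real \<Rightarrow> real) \<Rightarrow> (real \<Rightarrow> real \<Rightarrow> real) \<Rightarrow> bool" where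
  "prop_CP N f \<longleftrightarrow> (\<forall>x\<in>unit_ivl. \<forall>y\<in>unit_ivl. f x y = f (N y) (N x))"

definition prop_OP :: "(real \<Rightarrow> real \<Rightarrow> real) \<Rightarrow> bool" where
  "prop_OP f \<longleftrightarrow> (\<forall>x\<in>unit_ivl. \<forall>y\<in>unit_ivl. f x y = 1 \<longleftrightarrow> x \<le> y)"

text \<open>The conjuncts after the first are (REF1) to (REF5), in this order.\<close>

definition restricted_equivalence_function ::
  "(real \<Rightarrow> real) \<Rightarrow> (real \<Rightarrow> real \<Rightarrow> real) \<Rightarrow> bool" where
  "restricted_equivalence_function N F \<longleftrightarrow>
     unit_binary_map F \<and>
     (\<forall>x\<in>unit_ivl. \<forall>y\<in>unit_ivl. F x y = F y x) \<and>
     (\<forall>x\<in>unit_ivl. \<forall>y\<in>unit_ivl. F x y = 1 \<longleftrightarrow> x = y) \<and>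
     (\<forall>x\<in>unit_ivl. \<forall>y\<in>unit_ivl.
        F x y = 0 \<longleftrightarrow> (x = 1 \<and> y = 0) \<or> (x = 0 \<and> y = 1)) \<and>
     (\<forall>x\<in>unit_ivl. \<forall>y\<in>unit_ivl. F x y = F (N x) (N y)) \<and>
     (\<forall>x\<in>unit_ivl. \<forall>y\<in>unit_ivl. \<forall>z\<in>unit_ivl.
        x \<le> y \<and> y \<le> z \<longrightarrow> F x z \<le> F x y)"

end

theory Submission
  imports Defs
begin

text \<open>
  The order property makes one of \<open>f x y\<close>, \<open>f y x\<close> equal to 1, and for \<open>x \<le> y\<close> it is the first.
  So only the values of \<open>M\<close> on the edge where one argument is 1 matter: for \<open>x \<le> y\<close> the
  map under study is \<open>M 1 (f y x)\<close>. One strictness identifies the points of this edge where \<open>M\<close>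
  is 1, and lemma \<open>aggregation_eq_0_on_edge_iff\<close> the points where it is 0; through (OP) and (CC)
  these become (REF2) and (REF3). Monotonicity in (REF5) is that of \<open>M\<close> in its second argument
  combined with (I1). By (CP), negating both arguments of \<open>f\<close> has the same effect as swapping
  them, so that (REF4), like (REF1), comes down to the commutativity of \<open>M\<close>.
\<close>

text \<open>
  Zero divisors are interior points, so their absence does not speak of the edge directly.
  But an interior zero \<open>b\<close> on the edge would be a zero divisor, since \<open>M b b \<le> M 1 b\<close>.
\<close>

lemma aggregation_eq_0_on_edge_iff:
  assumes M: "aggregation_function M" and comm: "commutative_map M"
    and nzd: "\<nexists>x. zero_divisor M x" and M01: "M 0 1 = 0" and b: "b \<in> unit_ivl"
  shows "M 1 b = 0 \<longleftrightarrow> b = 0"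
proof
  assume "b = 0"
  then show "M 1 b = 0"
    using comm M01 unfolding commutative_map_def by simp
next
  assume zero: "M 1 b = 0"
  have "b \<noteq> 1"
    using zero M unfolding aggregation_function_def by auto
  moreover have "b \<notin> {0<..<1}"
  proof
    assume inner: "b \<in> {0<..<1}"
    have "M b b \<le> M 1 b"
      using M b unfolding aggregation_function_def mono_on_def by simp
    moreover have "0 \<le> M b b"
      using M b unfolding aggregation_function_def unit_binary_map_def
      by (auto simp: Pi_iff)
    ultimately have "zero_divisor M b"
      using zero inner unfolding zero_divisor_def by force
    with nzd show False by blast
  qed
  ultimately show "b = 0"
    using b by auto
qed

theorem theorem3p13:
  fixes N :: "real \<Rightarrow> real" and M f :: "real \<Rightarrow> real \<Rightarrow> real"
  assumes "strong_negation N"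
    and "aggregation_function M"
    and "commutative_map M"
    and "one_strict M"
    and "\<nexists>x. zero_divisor M x"
    and "M 0 1 = 0"
    and "unit_binary_map f"
    and "prop_I1 f"
    and "prop_CC f"
    and "prop_CP N f"
    and "prop_OP f"
  shows "restricted_equivalence_function N (\<lambda>x y. M (f x y) (f y x))"
proof -
  let ?G = "\<lambda>x y. M (f x y) (f y x)"
  have f_ivl: "f x y \<in> unit_ivl" if "x \<in> unit_ivl" "y \<in> unit_ivl" for x y
    using assms(7) that unfolding unit_binary_map_def by (auto simp: Pi_iff)
  have M_ivl: "M a b \<in> unit_ivl" if "a \<in> unit_ivl" "b \<in> unit_ivl" for a b
    using assms(2) that unfolding aggregation_function_def unit_binary_map_def
    by (auto simp: Pi_iff)
  have f_eq_1_iff: "f x y = 1 \<longleftrightarrow> x \<le> y" if "x \<in> unit_ivl" "y \<in> unit_ivl" for x y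
    using assms(11) that unfolding prop_OP_def by blast
  have f_eq_0_iff: "f x y = 0 \<longleftrightarrow> x = 1 \<and> y = 0" if "x \<in> unit_ivl" "y \<in> unit_ivl" for x y
    using assms(9) that unfolding prop_CC_def by blast
  have G_ordered: "?G x y = M 1 (f y x)" if "x \<in> unit_ivl" "y \<in> unit_ivl" "x \<le> y" for x y
    using f_eq_1_iff[OF that(1,2)] that(3) by simp

  have "unit_binary_map ?G"
    unfolding unit_binary_map_def by (intro Pi_I M_ivl f_ivl)
  moreover have REF1: "?G x y = ?G y x" if "x \<in> unit_ivl" "y \<in> unit_ivl" for x y
    using assms(3) f_ivl that unfolding commutative_map_def by blast
  moreover have "?G x y = 1 \<longleftrightarrow> x = y" if "x \<in> unit_ivl" "y \<in> unit_ivl" for x y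
  proof
    assume "?G x y = 1"
    then have "f x y = 1" "f y x = 1"
      using assms(4) f_ivl that unfolding one_strict_def by blast+
    then show "x = y"
      using f_eq_1_iff[OF that] f_eq_1_iff[OF that(2,1)] by simp
  next
    assume "x = y"
    moreover have "M 1 1 = 1"
      using assms(2) unfolding aggregation_function_def by blast
    ultimately show "?G x y = 1"
      using f_eq_1_iff[OF that] by simp
  qed
  moreover have "?G x y = 0 \<longleftrightarrow> (x = 1 \<and> y = 0) \<or> (x = 0 \<and> y = 1)"
    if "x \<in> unit_ivl" "y \<in> unit_ivl" for x y
  proof -
    have ordered: "?G u v = 0 \<longleftrightarrow> u = 0 \<and> v = 1"
      if "u \<in> unit_ivl" "v \<in> unit_ivl" "u \<le> v" for u v
    proof -
      have "?G u v = 0 \<longleftrightarrow> f v u = 0"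
        using G_ordered[OF that]
          aggregation_eq_0_on_edge_iff[OF assms(2,3,5,6) f_ivl[OF that(2,1)]] by simp
      then show ?thesis
        using f_eq_0_iff[OF that(2,1)] by blast
    qed
    show ?thesis
    proof (cases "x \<le> y")
      case True
      then show ?thesis
        using ordered[OF that] by auto
    next
      case False
      then show ?thesis
        using ordered[OF that(2,1)] REF1[OF that] by auto
    qed
  qed
  moreover have "?G x y = ?G (N x) (N y)" if "x \<in> unit_ivl" "y \<in> unit_ivl" for x y
  proof -
    have "f y x = f (N x) (N y)" "f x y = f (N y) (N x)"
      using assms(10) that unfolding prop_CP_def by blast+
    then show ?thesis
      using REF1[OF that] by simp
  qed
  moreover have "?G x z \<le> ?G x y"
    if "x \<in> unit_ivl" "y \<in> unit_ivl" "z \<in> unit_ivl" "x \<le> y" "y \<le> z" for x y z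
  proof -
    have "f z x \<le> f y x"
      using assms(8) that unfolding prop_I1_def monotone_on_def by blast
    moreover have "mono_on unit_ivl (M 1)"
      using assms(2) unfolding aggregation_function_def by simp
    ultimately have "M 1 (f z x) \<le> M 1 (f y x)"
      using f_ivl that by (blast dest: mono_onD)
    then show ?thesis
      using G_ordered[OF that(1,2,4)] G_ordered[OF that(1,3)] that(4,5) by simp
  qed
  ultimately show ?thesis
    unfolding restricted_equivalence_function_def by blast
qed

end
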